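(* Let $\mathcal{O}\subseteq K$ be an oval in $K$ with nucleus $0$ (so every line through $0$ contains exactly one point of $\mathcal{O}$). Define $f:K\to\mathbb{F}_2$ by $f(0)=0$ and $f(x)=tr(x/v)$ for $x\in vF$, where $v$ is the unique element of $\mathcal{O}$ with $x\in vF=\{\lambda v:\lambda\in F\}$. Then $f$ is a Niho bent function and $$f(x)=\sum_{v\in\mathcal{O}}\Bigl[\bigl(x^{q^2-q}-v^{q^2-q}\bigr)^{q^2-1}+1\Bigr]\sum_{j=0}^{m-1}(x/v)^{2^j}.$$
   Context: Let $m\ge1$, $q=2^m$, $F=\mathbb{F}_q\subseteq K=\mathbb{F}_{q^2}$, $tr:F\to\mathbb{F}_2$ and $Tr:K\to\mathbb{F}_2$ absolute traces, $S=\{u\in K:u^{q+1}=1\}$. $K$ is regarded as the affine plane $AG(2,q)$. An oval is a set of $q+1$ points no three collinear; its nucleus is the unique point through which all its tangent lines (lines meeting it in exactly one point) pass; an oval in $K$ with nucleus $0$ is an oval contained in $K$ with nucleus $0\in K$. A function $f:K\to\mathbb{F}_2$ is bent if $\sum_{x\in K}(-1)^{f(x)+Tr(bx)}=\pm q$ for all $b\in K$; a Niho bent function is a bent function whose restriction to each set $uF$, $u\in S$, is $\mathbb{F}_2$-linear. *)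

theory Defs
  imports "HOL-Computational_Algebra.Computational_Algebra"
begin

text \<open>
  The field $K$ is the whole type \<open>'a :: finite_field\<close>, its subfield $F$ is a set, and
  $\mathbf{F}_2$ is the prime subfield \<open>{0, 1}\<close> of $K$.  So $\mathbf{F}_2$-valued functions
  take values in \<open>'a\<close>, together with an explicit range condition.
\<close>

definition is_subfield :: "'a::field set \<Rightarrow> bool" where
  "is_subfield F \<longleftrightarrow> 0 \<in> F \<and> 1 \<in> F \<and>
     (\<forall>x\<in>F. \<forall>y\<in>F. x + y \<in> F \<and> x - y \<in> F \<and> x * y \<in> F) \<and> (\<forall>x\<in>F. inverse x \<in> F)"

text \<open>For \<open>x\<close> in the field with $2^n$ elements; thus \<open>abs_trace m\<close> is $tr$ on $F$ and
  \<open>abs_trace (2 * m)\<close> is $Tr$ on $K$.\<close>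

definition abs_trace :: "nat \<Rightarrow> 'a::field \<Rightarrow> 'a" where
  "abs_trace n x = (\<Sum>j<n. x ^ (2 ^ j))"

definition multiples :: "'a::field set \<Rightarrow> 'a \<Rightarrow> 'a set" where
  "multiples F v = {t * v | t. t \<in> F}"


subsection \<open>Ovals in the affine plane \<open>K\<close> over \<open>F\<close>\<close>

definition is_line :: "'a::field set \<Rightarrow> 'a set \<Rightarrow> bool" where
  "is_line F L \<longleftrightarrow> (\<exists>a d. d \<noteq> 0 \<and> L = {a + t * d | t. t \<in> F})"

definition collinear_pts :: "'a::field set \<Rightarrow> 'a set \<Rightarrow> bool" where
  "collinear_pts F A \<longleftrightarrow> (\<exists>L. is_line F L \<and> A \<subseteq> L)"

definition is_oval :: "'a::field set \<Rightarrow> 'a set \<Rightarrow> bool" where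
  "is_oval F Ov \<longleftrightarrow> card Ov = card F + 1 \<and>
     (\<forall>A. A \<subseteq> Ov \<and> card A = 3 \<longrightarrow> \<not> collinear_pts F A)"

definition is_tangent :: "'a::field set \<Rightarrow> 'a set \<Rightarrow> 'a set \<Rightarrow> bool" where
  "is_tangent F Ov L \<longleftrightarrow> is_line F L \<and> card (L \<inter> Ov) = 1"

definition is_nucleus :: "'a::field set \<Rightarrow> 'a set \<Rightarrow> 'a \<Rightarrow> bool" where
  "is_nucleus F Ov p \<longleftrightarrow> {r. \<forall>L. is_tangent F Ov L \<longrightarrow> r \<in> L} = {p}"


subsection \<open>Niho bent functions\<close>

text \<open>$(-1)^a$ for \<open>a\<close> in the prime field \<open>{0, 1}\<close>.\<close>

definition sign :: "'a::field \<Rightarrow> int" where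
  "sign a = (if a = 0 then 1 else -1)"

text \<open>Here \<open>K\<close> is meant to have $q^2$ elements with $q = 2^m$.\<close>

definition bent :: "nat \<Rightarrow> ('a::finite_field \<Rightarrow> 'a) \<Rightarrow> bool" where
  "bent m f \<longleftrightarrow> (\<forall>x. f x \<in> {0, 1}) \<and>
     (\<forall>b. (\<Sum>x\<in>UNIV. sign (f x + abs_trace (2 * m) (b * x))) \<in> {2 ^ m, - (2 ^ m)})"

definition F2_linear_on :: "'a::field set \<Rightarrow> ('a \<Rightarrow> 'a) \<Rightarrow> bool" where
  "F2_linear_on A f \<longleftrightarrow> (\<forall>x\<in>A. \<forall>y\<in>A. f (x + y) = f x + f y) \<and>
     (\<forall>c\<in>{0, 1}. \<forall>x\<in>A. f (c * x) = c * f x)"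

definition niho_bent :: "nat \<Rightarrow> 'a::finite_field set \<Rightarrow> ('a \<Rightarrow> 'a) \<Rightarrow> bool" where
  "niho_bent m F f \<longleftrightarrow> bent m f \<and>
     (\<forall>u. u ^ (2 ^ m + 1) = 1 \<longrightarrow> F2_linear_on (multiples F u) f)"

definition oval_fun :: "nat \<Rightarrow> 'a::field set \<Rightarrow> 'a set \<Rightarrow> 'a \<Rightarrow> 'a" where
  "oval_fun m F Ov x =
     (if x = 0 then 0 else abs_trace m (x / (THE v. v \<in> Ov \<and> x \<in> multiples F v)))"

end

theory Submission
  imports Defs
begin

text \<open>
  Since \<open>x / y \<in> F\<close> iff \<open>x ^ (q - 1) = y ^ (q - 1)\<close>, the map \<open>x \<mapsto> x ^ (q - 1)\<close> labels the
  \<open>q + 1\<close> lines through a point by their directions.  A point of the oval sees the \<open>q\<close> other points in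
  at most \<open>q\<close> directions, so it has a tangent, which passes through \<open>0\<close>; hence the lines through
  \<open>0\<close> are exactly the tangents.  Splitting the Walsh sum at \<open>b\<close> along these lines leaves, for
  each \<open>v\<close> of the oval, the sum over \<open>F\<close> of the additive character \<open>t \<mapsto> tr (t (1 + b v + (b v)\<^sup>q))\<close>.
  The sum therefore equals \<open>q (N - 1)\<close>, where \<open>N\<close> counts the points of the oval with
  \<open>b v + (b v)\<^sup>q = 1\<close>.  These lie on a line missing \<open>0\<close>, which is not a tangent, so
  \<open>N\<close> is \<open>0\<close> or \<open>2\<close>.
\<close>

section \<open>Arithmetic of \<open>K\<close> and \<open>F\<close> in characteristic 2\<close>

lemma card_nth_roots_le:
  fixes c :: "'a::idom"
  assumes "n > 0"
  shows "card {x. x ^ n = c} \<le> n"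
proof -
  let ?p = "monom 1 n - [:c:]"
  \<comment> \<open>Since \<open>n > 0\<close>, the constant \<open>c\<close> does not touch the
    leading coefficient.\<close>
  have "coeff ?p n = 1"
    using assms by (cases n) auto
  then have p0: "?p \<noteq> 0"
    by force
  have roots: "{x. x ^ n = c} = {x. poly ?p x = 0}"
    by (simp add: poly_monom)
  have "card {x. x ^ n = c} \<le> degree ?p"
    unfolding roots by (rule card_poly_roots_bound[OF p0])
  also have "\<dots> \<le> n"
    by (rule degree_diff_le) (auto simp: degree_monom_le)
  finally show "card {x. x ^ n = c} \<le> n" .
qed

locale even_quadratic_extension =
  fixes F :: "'a::finite_field set" and m q :: nat
  assumes m_pos: "m \<ge> 1" and q_def: "q = 2 ^ m"
    and card_K: "card (UNIV :: 'a set) = q ^ 2"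
    and subfield: "is_subfield F" and card_F: "card F = q"
begin

lemma q_ge_2: "q \<ge> 2"
  using m_pos unfolding q_def by (cases m) auto

lemma pow_q_sq: "(x::'a) ^ (q ^ 2) = x"
  using finite_field_power_card_eq_same[of x] card_K by simp

lemma pow_q_q: "((x::'a) ^ q) ^ q = x"
  using pow_q_sq[of x] by (simp add: power_mult power2_eq_square)

lemma pow_q_sq_minus_1:
  assumes "(x::'a) \<noteq> 0"
  shows "x ^ (q ^ 2 - 1) = 1"
proof -
  have "x * x ^ (q ^ 2 - 1) = x ^ Suc (q ^ 2 - 1)"
    by simp
  also have "Suc (q ^ 2 - 1) = q ^ 2"
    using q_ge_2 by simp
  finally show ?thesis
    using assms pow_q_sq by simp
qed

text \<open>The power map with exponent \<open>q ^ 2\<close> fixes -1, and the exponent is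
  even.\<close>

lemma one_plus_one: "(1::'a) + 1 = 0"
proof -
  have "even (q ^ 2)"
    using m_pos by (simp add: q_def)
  then have "(1::'a) = - 1"
    using pow_q_sq[of "-1"] by simp
  then show ?thesis
    by (metis add.right_inverse)
qed

lemma add_self [simp]: "(x::'a) + x = 0"
  using one_plus_one by (metis distrib_left mult.right_neutral mult_zero_right)

lemma two_eq_0 [simp]: "(2::'a) = 0"
  using one_plus_one unfolding one_add_one .

lemma minus_eq [simp]: "- (x::'a) = x"
  by (rule minus_unique) (rule add_self)

text \<open>As a simp rule this turns all differences into sums, so signs disappear from later
  calculations.\<close>

lemma diff_eq_add [simp]: "(x::'a) - y = x + y"
  using minus_eq[of y] by (metis diff_conv_add_uminus)

lemma add_eq_0_iff_eq: "(x::'a) + y = 0 \<longleftrightarrow> x = y"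
  by (metis diff_eq_add eq_iff_diff_eq_0)

lemma power_two_power_add: "((x::'a) + y) ^ (2 ^ n) = x ^ (2 ^ n) + y ^ (2 ^ n)"
proof (induction n)
  case (Suc n)
  have sq: "(a + b) ^ 2 = a ^ 2 + b ^ 2" for a b :: 'a
  proof -
    have "(a + b) ^ 2 = a ^ 2 + b ^ 2 + (a * b + a * b)"
      by (simp add: power2_eq_square algebra_simps del: add_self)
    then show ?thesis
      by simp
  qed
  show ?case
    using Suc by (simp add: power_mult sq mult.commute[of 2])
qed simp

lemma power_q_add: "((x::'a) + y) ^ q = x ^ q + y ^ q"
  unfolding q_def by (rule power_two_power_add)

lemma F_closed:
  "0 \<in> F" "1 \<in> F" "x \<in> F \<Longrightarrow> y \<in> F \<Longrightarrow> x + y \<in> F" "x \<in> F \<Longrightarrow> y \<in> F \<Longrightarrow> x * y \<in> F"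
  "x \<in> F \<Longrightarrow> y \<in> F \<Longrightarrow> x / y \<in> F"
  using subfield by (auto simp: is_subfield_def divide_inverse)

lemma pow_q_eq_mult: "(x::'a) ^ q = x * x ^ (q - 1)"
  using q_ge_2 by (cases q) auto

text \<open>Multiplication by \<open>x\<close> permutes \<open>F - {0}\<close>; compare the products
  of all elements before and after.\<close>

lemma F_pow_q_minus_1:
  assumes "x \<in> F" "x \<noteq> 0"
  shows "x ^ (q - 1) = 1"
proof -
  have bij: "bij_betw (\<lambda>t. x * t) (F - {0}) (F - {0})"
    by (rule bij_betw_byWitness[where f' = "\<lambda>t. t / x"]) (use assms F_closed in auto)
  have "(\<Prod>t\<in>F - {0}. t) = (\<Prod>t\<in>F - {0}. x * t)"
    using prod.reindex_bij_betw[OF bij, of "\<lambda>t. t"] by simp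
  also have "\<dots> = x ^ card (F - {0}) * (\<Prod>t\<in>F - {0}. t)"
    by (simp add: prod.distrib)
  also have "card (F - {0}) = q - 1"
    using F_closed(1) card_F by simp
  finally show ?thesis
    by simp
qed

text \<open>Every element of \<open>F\<close> is a root of \<open>x ^ q = x\<close>, which has at
  most 1 + (q - 1) roots in \<open>K\<close>. Since \<open>card F = q\<close>, there are no
  others.\<close>

lemma mem_F_iff: "x \<in> F \<longleftrightarrow> x ^ q = x"
proof -
  have "{x. x ^ q = x} \<subseteq> {0::'a} \<union> {x. x ^ (q - 1) = 1}"
    by (auto simp: pow_q_eq_mult)
  then have "card {x::'a. x ^ q = x} \<le> card ({0::'a} \<union> {x. x ^ (q - 1) = 1})"
    by (intro card_mono) auto
  also have "\<dots> \<le> 1 + card {x::'a. x ^ (q - 1) = 1}"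
    using card_Un_le[of "{0::'a}"] by simp
  also have "\<dots> \<le> q"
    using card_nth_roots_le[of "q - 1" "1::'a"] q_ge_2 by simp
  finally have "card {x::'a. x ^ q = x} \<le> card F"
    by (simp add: card_F)
  moreover have "F \<subseteq> {x. x ^ q = x}"
    using F_pow_q_minus_1 q_ge_2 by (auto simp: pow_q_eq_mult)
  ultimately have "F = {x. x ^ q = x}"
    by (intro card_seteq) auto
  then show ?thesis
    by blast
qed

section \<open>Directions of lines\<close>

lemma div_mem_F_iff:
  assumes "x \<noteq> 0" "y \<noteq> 0"
  shows "x / y \<in> F \<longleftrightarrow> x ^ (q - 1) = y ^ (q - 1)"
proof -
  have "x / y \<in> F \<longleftrightarrow> (x / y) ^ (q - 1) = 1"
    unfolding mem_F_iff pow_q_eq_mult[of "x / y"] using assms by simp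
  also have "\<dots> \<longleftrightarrow> x ^ (q - 1) = y ^ (q - 1)"
    using assms by (simp add: power_divide)
  finally show ?thesis .
qed

lemma mem_multiples_iff:
  assumes "v \<noteq> 0"
  shows "x \<in> multiples F v \<longleftrightarrow> x / v \<in> F"
  using assms by (auto simp: multiples_def intro!: exI[of _ "x / v"])

text \<open>This is the group S of (q + 1)-th roots of unity, with one element for each line through
  0.\<close>

definition directions :: "'a set" where
  "directions = (\<lambda>d. d ^ (q - 1)) ` (UNIV - {0})"

text \<open>At most q + 1: all directions are roots of \<open>u ^ (q + 1) = 1\<close>. At least q +
  1: the q^2 - 1 nonzero elements are covered by fibres of size at most q - 1.\<close>

lemma card_directions: "card directions = q + 1"
proof (rule antisym)
  have "d ^ ((q - 1) * (q + 1)) = 1" if "d \<noteq> 0" for d :: 'a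
  proof -
    have "(q - 1) * (q + 1) = q ^ 2 - 1"
      by (simp add: power2_eq_square algebra_simps)
    then show ?thesis
      using pow_q_sq_minus_1[OF that] by simp
  qed
  then have "directions \<subseteq> {u. u ^ (q + 1) = 1}"
    unfolding directions_def by (auto simp only: power_mult)
  then have "card directions \<le> card {u::'a. u ^ (q + 1) = 1}"
    by (intro card_mono) auto
  then show "card directions \<le> q + 1"
    using card_nth_roots_le[of "q + 1" "1::'a"] by simp
next
  have "UNIV - {0} \<subseteq> (\<Union>s\<in>directions. {x::'a. x ^ (q - 1) = s})"
    by (auto simp: directions_def)
  then have "card (UNIV - {0::'a}) \<le> card (\<Union>s\<in>directions. {x::'a. x ^ (q - 1) = s})"
    by (intro card_mono) auto
  also have "\<dots> \<le> (\<Sum>s\<in>directions. card {x::'a. x ^ (q - 1) = s})"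
    by (intro card_UN_le) simp
  also have "\<dots> \<le> (\<Sum>s\<in>directions. q - 1)"
    using q_ge_2 by (intro sum_mono card_nth_roots_le) simp
  finally have "q ^ 2 - 1 \<le> card directions * (q - 1)"
    by (simp add: card_K)
  moreover have "q ^ 2 - 1 = (q + 1) * (q - 1)"
    by (simp add: power2_eq_square algebra_simps)
  ultimately show "q + 1 \<le> card directions"
    using q_ge_2 by (metis mult_le_cancel2 zero_less_diff Suc_1 Suc_le_lessD)
qed

section \<open>Absolute traces and additive characters of \<open>F\<close>\<close>

lemma abs_trace_add: "abs_trace n ((x::'a) + y) = abs_trace n x + abs_trace n y"
  by (simp add: abs_trace_def power_two_power_add sum.distrib)

lemma abs_trace_0 [simp]: "abs_trace n (0::'a) = 0"
  by (simp add: abs_trace_def zero_power)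

text \<open>Squaring shifts the summands of the trace cyclically, because
  \<open>x ^ (2 ^ m) = x\<close>. So the trace is its own square.\<close>

lemma abs_trace_F:
  assumes "x \<in> F"
  shows "abs_trace m x \<in> {0, 1}"
proof -
  have sq: "(sum g A) ^ 2 = (\<Sum>i\<in>A. g i ^ 2)" if "finite A" for g :: "nat \<Rightarrow> 'a" and A
    using that by induction (use power_two_power_add[of _ _ 1] in auto)
  have "abs_trace m x ^ 2 = (\<Sum>j<m. x ^ (2 ^ Suc j))"
    by (simp add: abs_trace_def sq mult.commute flip: power_mult)
  \<comment> \<open>Both sides are the sum over j \<le> m, with the first or the last term split
    off.\<close>
  moreover have "(\<Sum>j<m. x ^ (2 ^ Suc j)) + x ^ (2 ^ 0) = (\<Sum>j<m. x ^ (2 ^ j)) + x ^ (2 ^ m)"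
    using sum.lessThan_Suc[of "\<lambda>j. x ^ (2 ^ j)" m] sum.lessThan_Suc_shift[of "\<lambda>j. x ^ (2 ^ j)" m]
    by (simp only: add.commute)
  moreover have "x ^ (2 ^ m) = x"
    using assms by (simp add: mem_F_iff flip: q_def)
  ultimately have "abs_trace m x ^ 2 = abs_trace m x"
    by (simp add: abs_trace_def)
  then show ?thesis
    by (simp add: power2_eq_square)
qed

text \<open>Transitivity of the trace: the upper m of the 2m summands form the trace of
  \<open>x ^ q\<close>, and \<open>x + x ^ q\<close> is the relative trace from \<open>K\<close> to
  \<open>F\<close>.\<close>

lemma abs_trace_double: "abs_trace (2 * m) (x::'a) = abs_trace m (x + x ^ q)"
proof -
  have "abs_trace (m + k) x = abs_trace m x + (\<Sum>j<k. x ^ (2 ^ (m + j)))" for k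
    by (induction k) (simp_all add: abs_trace_def add.assoc)
  then have "abs_trace (2 * m) x = abs_trace m x + (\<Sum>j<m. x ^ (2 ^ (m + j)))"
    by (simp add: mult_2)
  also have "\<dots> = abs_trace m x + abs_trace m (x ^ q)"
    by (simp add: abs_trace_def q_def power_add flip: power_mult)
  finally show ?thesis
    by (simp add: abs_trace_add)
qed

text \<open>Otherwise all q elements of \<open>F\<close> would be roots of the trace polynomial,
  which is nonzero of degree at most q/2.\<close>

lemma abs_trace_surj: "\<exists>x\<in>F. abs_trace m x = 1"
proof (rule ccontr)
  let ?p = "\<Sum>j<m. monom (1::'a) (2 ^ j)"
  assume "\<not> ?thesis"
  then have "F \<subseteq> {x. poly ?p x = 0}"
    using abs_trace_F by (auto simp: abs_trace_def poly_sum poly_monom)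
  then have "q \<le> card {x. poly ?p x = 0}"
    unfolding card_F[symmetric] by (intro card_mono) auto
  moreover have "coeff ?p 1 = 1"
  proof -
    \<comment> \<open>Only the summand with \<open>j = 0\<close> has exponent 1.\<close>
    have "coeff ?p 1 = (\<Sum>j<m. if j = 0 then 1 else 0)"
      unfolding coeff_sum by (intro sum.cong) auto
    then show ?thesis
      using m_pos by simp
  qed
  then have "?p \<noteq> 0"
    by force
  then have "card {x. poly ?p x = 0} \<le> degree ?p"
    by (rule card_poly_roots_bound)
  moreover have "degree ?p \<le> 2 ^ (m - 1)"
    by (intro degree_sum_le) (auto intro!: order_trans[OF degree_monom_le] power_increasing)
  moreover have "2 ^ (m - 1) < q"
    using m_pos unfolding q_def by (intro power_strict_increasing) auto
  ultimately show False
    by linarith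
qed

text \<open>Orthogonality of characters: for \<open>c\<close> nonzero, translating \<open>t\<close>
  by \<open>y / c\<close> with \<open>y\<close> of trace 1 flips every sign, so the sum equals its
  own negative.\<close>

lemma sum_sign_abs_trace:
  assumes "c \<in> F"
  shows "(\<Sum>t\<in>F. sign (abs_trace m (t * c))) = (if c = 0 then int q else 0)"
proof (cases "c = 0")
  case True
  then show ?thesis
    by (simp add: sign_def card_F)
next
  case False
  obtain y where y: "y \<in> F" "abs_trace m y = 1"
    using abs_trace_surj by blast
  let ?S = "\<Sum>t\<in>F. sign (abs_trace m (t * c))"
  have bij: "bij_betw (\<lambda>t. t + y / c) F F"
    by (rule bij_betw_byWitness[where f' = "\<lambda>t. t + y / c"])
      (use y assms F_closed in \<open>auto simp: add.assoc\<close>)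
  have "?S = (\<Sum>t\<in>F. sign (abs_trace m ((t + y / c) * c)))"
    using sum.reindex_bij_betw[OF bij, of "\<lambda>t. sign (abs_trace m (t * c))"] by simp
  also have "\<dots> = (\<Sum>t\<in>F. sign (abs_trace m (t * c) + 1))"
    using False y by (simp add: distrib_right abs_trace_add)
  also have "\<dots> = (\<Sum>t\<in>F. - sign (abs_trace m (t * c)))"
  proof (rule sum.cong)
    fix t assume "t \<in> F"
    then have "abs_trace m (t * c) \<in> {0, 1}"
      using assms by (intro abs_trace_F F_closed)
    then show "sign (abs_trace m (t * c) + 1) = - sign (abs_trace m (t * c))"
      by (auto simp: sign_def)
  qed simp
  also have "\<dots> = - ?S"
    by (simp add: sum_negf)
  finally show ?thesis
    using False by simp
qed

end

section \<open>Tangents of the oval and lines through its nucleus\<close>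

locale oval_nucleus_0 = even_quadratic_extension F m q
  for F :: "'a::finite_field set" and m q +
  fixes Ov :: "'a set"
  assumes oval: "is_oval F Ov" and nucleus: "is_nucleus F Ov 0"
begin

lemma card_Ov: "card Ov = q + 1"
  using oval card_F by (simp add: is_oval_def)

lemma tangent_through_0: "is_tangent F Ov L \<Longrightarrow> 0 \<in> L"
  using nucleus unfolding is_nucleus_def by blast

lemma tangent_exists:
  assumes p: "p \<in> Ov"
  shows "\<exists>L. is_tangent F Ov L \<and> p \<in> L"
proof -
  have "card ((\<lambda>v. (v - p) ^ (q - 1)) ` (Ov - {p})) \<le> card (Ov - {p})"
    by (rule card_image_le) simp
  also have "\<dots> < card directions"
    using p card_Ov card_directions by simp
  finally obtain s where s: "s \<in> directions" "s \<notin> (\<lambda>v. (v - p) ^ (q - 1)) ` (Ov - {p})"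
    by (metis card_mono finite subsetI linorder_not_le)
  then obtain d where d: "d \<noteq> 0" "d ^ (q - 1) \<notin> (\<lambda>v. (v - p) ^ (q - 1)) ` (Ov - {p})"
    unfolding directions_def by auto
  \<comment> \<open>The line through \<open>p\<close> in a direction \<open>d\<close> that no other
    oval point occupies: a second oval point \<open>v\<close> on it would make \<open>v - p\<close>
    an \<open>F\<close>-multiple of \<open>d\<close>.\<close>
  let ?L = "{p + t * d | t. t \<in> F}"
  have pL: "p \<in> ?L"
    using F_closed(1) by force
  have "v = p" if v: "v \<in> Ov" "v \<in> ?L" for v
  proof (rule ccontr)
    assume "v \<noteq> p"
    obtain t where t: "t \<in> F" "v = p + t * d"
      using v by blast
    then have "v - p = t * d"
      by (metis add_diff_cancel_left')
    then have "(v - p) / d \<in> F"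
      using d t(1) by (simp del: diff_eq_add)
    then have "d ^ (q - 1) = (v - p) ^ (q - 1)"
      using d \<open>v \<noteq> p\<close> by (subst (asm) div_mem_F_iff) (auto simp: add_eq_0_iff_eq)
    moreover have "(v - p) ^ (q - 1) \<in> (\<lambda>v. (v - p) ^ (q - 1)) ` (Ov - {p})"
      using v \<open>v \<noteq> p\<close> by blast
    ultimately show False
      using d(2) by simp
  qed
  then have "?L \<inter> Ov = {p}"
    using p pL by blast
  then have "is_tangent F Ov ?L"
    using d unfolding is_tangent_def is_line_def by auto
  then show ?thesis
    using pL by blast
qed

lemma tangent_unique_point:
  assumes "is_tangent F Ov L" "v \<in> L" "w \<in> L" "v \<in> Ov" "w \<in> Ov"
  shows "v = w"
  using assms unfolding is_tangent_def by (metis IntI card_1_singletonE singletonD)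

text \<open>Otherwise the tangent at another oval point \<open>p\<close> would contain two oval
  points, \<open>p\<close> and 0.\<close>

lemma zero_notin_Ov: "0 \<notin> Ov"
proof
  assume 0: "0 \<in> Ov"
  have "\<not> Ov \<subseteq> {0}"
    using card_Ov q_ge_2 card_mono[of "{0}" Ov] by auto
  then obtain p where "p \<in> Ov" "p \<noteq> 0"
    by blast
  then show False
    using tangent_exists tangent_through_0 tangent_unique_point 0 by metis
qed

lemma Ov_nonzero: "v \<in> Ov \<Longrightarrow> v \<noteq> 0"
  using zero_notin_Ov by blast

text \<open>The tangent at \<open>v\<close> passes through 0, so it contains every
  \<open>F\<close>-multiple of \<open>v\<close>. A second oval point of the same direction would lie
  on it as well.\<close>

lemma inj_on_direction: "inj_on (\<lambda>v. v ^ (q - 1)) Ov"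
proof (rule inj_onI)
  fix v w assume vw: "v \<in> Ov" "w \<in> Ov" "v ^ (q - 1) = w ^ (q - 1)"
  obtain L where L: "is_tangent F Ov L" "v \<in> L"
    using tangent_exists vw by blast
  obtain a d where ad: "L = {a + t * d | t. t \<in> F}"
    using L unfolding is_tangent_def is_line_def by blast
  obtain t where t: "t \<in> F" "v = a + t * d"
    using L ad by blast
  obtain s where s: "s \<in> F" "0 = a + s * d"
    using tangent_through_0[OF L(1)] ad by blast
  have a: "a = s * d"
    using s by (metis add_eq_0_iff_eq)
  have r: "w / v \<in> F"
    using vw Ov_nonzero by (simp add: div_mem_F_iff)
  have "w = (w / v) * v"
    using vw Ov_nonzero by simp
  also have "\<dots> = (w / v) * (s + t) * d"
    by (simp add: t(2) a algebra_simps)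
  also have "\<dots> = a + (s + (w / v) * (s + t)) * d"
    by (simp add: a distrib_right add.assoc[symmetric])
  finally have "w \<in> L"
    unfolding ad using r s(1) t(1) F_closed(3,4) by blast
  then show "v = w"
    using L vw tangent_unique_point by blast
qed

text \<open>The q + 1 oval points have distinct directions, hence exhaust all q + 1 of them.\<close>

lemma direction_image_Ov: "(\<lambda>v. v ^ (q - 1)) ` Ov = directions"
  using inj_on_direction Ov_nonzero card_directions card_Ov
  by (intro card_subset_eq) (auto simp: directions_def card_image)

lemma ex1_multiples:
  assumes "x \<noteq> 0"
  shows "\<exists>!v. v \<in> Ov \<and> x \<in> multiples F v"
proof -
  have "x ^ (q - 1) \<in> (\<lambda>v. v ^ (q - 1)) ` Ov"
    unfolding direction_image_Ov using assms by (auto simp: directions_def)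
  then obtain v where v: "v \<in> Ov" "x ^ (q - 1) = v ^ (q - 1)"
    by blast
  have "x \<in> multiples F w \<longleftrightarrow> w = v" if "w \<in> Ov" for w
    using that v assms Ov_nonzero inj_on_direction
    by (auto simp: mem_multiples_iff div_mem_F_iff inj_on_def)
  then show ?thesis
    using v by auto
qed

text \<open>A line through 0 with direction vector \<open>d\<close> is \<open>multiples F d\<close>.
  As oval points are nonzero, \<open>v\<close> lies on it iff \<open>d\<close> lies in
  \<open>multiples F v\<close>.\<close>

lemma ex1_line:
  assumes "is_line F L" "0 \<in> L"
  shows "\<exists>!v. v \<in> Ov \<and> v \<in> L"
proof -
  obtain a d where d: "d \<noteq> 0" and L: "L = {a + t * d | t. t \<in> F}"
    using assms unfolding is_line_def by blast
  obtain s where s: "s \<in> F" "0 = a + s * d"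
    using L assms by blast
  then have a: "a = s * d"
    by (metis add_eq_0_iff_eq)
  have "v \<in> L \<longleftrightarrow> d \<in> multiples F v" if "v \<in> Ov" for v
  proof -
    have "v \<in> L \<longleftrightarrow> v / d \<in> F"
    proof
      assume "v \<in> L"
      then obtain t where "t \<in> F" "v = (s + t) * d"
        unfolding L a by (auto simp: distrib_right)
      then show "v / d \<in> F"
        using d s F_closed by simp
    next
      assume r: "v / d \<in> F"
      have "v = s * d + (s + v / d) * d"
        using d by (simp add: distrib_right add.assoc[symmetric])
      then show "v \<in> L"
        unfolding L a using F_closed(3)[OF s(1) r] by blast
    qed
    also have "\<dots> \<longleftrightarrow> d / v \<in> F"
      using d that Ov_nonzero by (auto simp: div_mem_F_iff)
    finally show ?thesis
      using that Ov_nonzero by (simp add: mem_multiples_iff)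
  qed
  then show ?thesis
    using ex1_multiples[OF d] by metis
qed

section \<open>The oval function on the lines through 0\<close>

lemma oval_fun_eq:
  assumes "v \<in> Ov" "x \<in> multiples F v"
  shows "oval_fun m F Ov x = abs_trace m (x / v)"
proof (cases "x = 0")
  case False
  then have "(THE v. v \<in> Ov \<and> x \<in> multiples F v) = v"
    using assms ex1_multiples[OF False] by (intro the1_equality) auto
  then show ?thesis
    using False by (simp add: oval_fun_def)
\<comment> \<open>The point 0 lies on all these lines; there both sides are 0.\<close>
qed (simp add: oval_fun_def)

lemma oval_fun_range: "oval_fun m F Ov x \<in> {0, 1}"
proof (cases "x = 0")
  case False
  then obtain v where "v \<in> Ov" "x \<in> multiples F v"
    using ex1_multiples by blast
  then show ?thesis
    using oval_fun_eq abs_trace_F Ov_nonzero by (metis mem_multiples_iff)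
qed (simp add: oval_fun_def)

lemma F2_linear_on_oval_fun:
  assumes "u \<noteq> 0"
  shows "F2_linear_on (multiples F u) (oval_fun m F Ov)"
proof -
  obtain v where v: "v \<in> Ov" "u \<in> multiples F v"
    using ex1_multiples[OF assms] by blast
  have v0: "v \<noteq> 0" and uv: "u / v \<in> F"
    using v Ov_nonzero by (auto simp: mem_multiples_iff)
  \<comment> \<open>The line through \<open>u\<close> is the line through the oval point
    \<open>v\<close>, where the function is the additive map sending \<open>x\<close> to
    \<open>abs_trace m (x / v)\<close>.\<close>
  have mem: "x \<in> multiples F v" if "x \<in> multiples F u" for x
  proof -
    have "x / u \<in> F"
      using that assms by (simp add: mem_multiples_iff)
    then have "(x / u) * (u / v) \<in> F"
      using uv F_closed(4) by blast
    then show ?thesis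
      using assms v0 by (simp add: mem_multiples_iff)
  qed
  have "oval_fun m F Ov (x + y) = oval_fun m F Ov x + oval_fun m F Ov y"
    if "x \<in> multiples F u" "y \<in> multiples F u" for x y
  proof -
    have "x + y \<in> multiples F v"
      using that mem v0 F_closed by (auto simp: mem_multiples_iff add_divide_distrib)
    then show ?thesis
      using that mem v by (simp add: oval_fun_eq add_divide_distrib abs_trace_add)
  qed
  \<comment> \<open>Homogeneity over \<open>{0, 1}\<close> only asks for the value 0 at 0.\<close>
  then show ?thesis
    unfolding F2_linear_on_def by (auto simp: oval_fun_def)
qed

section \<open>The Walsh transform of the oval function\<close>

lemma sum_K_eq_sum_Ov:
  fixes g :: "'a \<Rightarrow> int"
  shows "(\<Sum>x\<in>UNIV. g x) = g 0 + (\<Sum>v\<in>Ov. \<Sum>t\<in>F - {0}. g (t * v))"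
proof -
  \<comment> \<open>The lines through 0, one for each oval point, partition the nonzero elements of
    \<open>K\<close>.\<close>
  have "bij_betw (\<lambda>(v, t). t * v) (Ov \<times> (F - {0})) (UNIV - {0})"
  proof (rule bij_betw_imageI)
    show "inj_on (\<lambda>(v, t). t * v) (Ov \<times> (F - {0}))"
    proof (rule inj_onI)
      fix x y assume "x \<in> Ov \<times> (F - {0})" "y \<in> Ov \<times> (F - {0})"
        "(case x of (v, t) \<Rightarrow> t * v) = (case y of (v, t) \<Rightarrow> t * v)"
      then obtain v t w s where xy: "x = (v, t)" "y = (w, s)"
        and *: "v \<in> Ov" "t \<in> F" "t \<noteq> 0" "w \<in> Ov" "s \<in> F" "s \<noteq> 0" "t * v = s * w"
        by auto
      from * have "t * v \<noteq> 0" "t * v \<in> multiples F v" "s * w \<in> multiples F w"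
        using Ov_nonzero unfolding multiples_def by (simp, blast+)
      then have "v = w"
        using * ex1_multiples by metis
      then show "x = y"
        using xy * Ov_nonzero by auto
    qed
  next
    have "x \<in> (\<lambda>(v, t). t * v) ` (Ov \<times> (F - {0}))" if x: "x \<noteq> 0" for x
    proof -
      obtain v t where "v \<in> Ov" "t \<in> F" "x = t * v"
        using ex1_multiples[OF x] by (auto simp: multiples_def)
      then show ?thesis
        using x by (intro image_eqI[of _ _ "(v, t)"]) auto
    qed
    then show "(\<lambda>(v, t). t * v) ` (Ov \<times> (F - {0})) = UNIV - {0}"
      using Ov_nonzero by auto
  qed
  from sum.reindex_bij_betw[OF this, of g]
  have "(\<Sum>x\<in>UNIV - {0}. g x) = (\<Sum>v\<in>Ov. \<Sum>t\<in>F - {0}. g (t * v))"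
    by (simp add: sum.cartesian_product case_prod_unfold)
  then show ?thesis
    by (simp add: sum.remove[of UNIV 0])
qed

lemma card_trace_one:
  defines "N \<equiv> \<lambda>b. card {v \<in> Ov. b * v + (b * v) ^ q = 1}"
  shows "N b \<in> {0, 2}"
proof (cases "N b = 0")
  case False
  let ?A = "{v \<in> Ov. b * v + (b * v) ^ q = 1}"
  obtain y where y: "y \<in> Ov" "b * y + (b * y) ^ q = 1"
    using False unfolding N_def by (metis (mono_tags, lifting) card.empty empty_Collect_eq)
  have b: "b \<noteq> 0"
    using y q_ge_2 by (auto simp: zero_power)
  \<comment> \<open>The relative trace has kernel \<open>F\<close>, so the solutions
    \<open>v\<close> of the trace equation form a coset of \<open>F\<close> scaled by
    \<open>inverse b\<close>: a line through \<open>y\<close>.\<close>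
  let ?L = "{y + t * inverse b | t. t \<in> F}"
  have L: "is_line F ?L"
    using b unfolding is_line_def by (metis inverse_nonzero_iff_nonzero)
  have mem: "v \<in> ?L \<longleftrightarrow> b * v + (b * v) ^ q = 1" for v
  proof -
    have "v \<in> ?L \<longleftrightarrow> b * v + b * y \<in> F"
    proof
      assume "v \<in> ?L"
      then obtain t where t: "t \<in> F" "v = y + t * inverse b"
        by blast
      then have "b * v + b * y = t"
        using b by (simp add: divide_inverse[symmetric] algebra_simps)
      then show "b * v + b * y \<in> F"
        using t by simp
    next
      assume r: "b * v + b * y \<in> F"
      have "v = y + (b * v + b * y) * inverse b"
      proof -
        have "(b * v + b * y) * inverse b = v + y"
          using b by (simp add: field_simps)
        then show ?thesis
          by (simp add: add.left_commute)
      qed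
      then show "v \<in> ?L"
        using r by blast
    qed
    also have "\<dots> \<longleftrightarrow> (b * v) ^ q + (b * y) ^ q = b * v + b * y"
      by (simp add: mem_F_iff power_q_add)
    also have "\<dots> \<longleftrightarrow> (b * v + (b * v) ^ q) + (b * y + (b * y) ^ q) = 0"
      by (subst add_eq_0_iff_eq[symmetric]) (simp add: algebra_simps)
    also have "\<dots> \<longleftrightarrow> b * v + (b * v) ^ q = 1"
      by (simp add: y(2) add_eq_0_iff_eq)
    finally show ?thesis .
  qed
  have A: "?A = ?L \<inter> Ov"
    using mem by blast
  \<comment> \<open>At 0 the relative trace is 0, not 1. So the line is no tangent, which excludes
    exactly one oval point on it.\<close>
  have "0 \<notin> ?L"
    unfolding mem using q_ge_2 by (simp add: zero_power)
  then have "N b \<noteq> 1"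
    using tangent_through_0[of ?L] L unfolding N_def A is_tangent_def by blast
  moreover have "\<not> N b \<ge> 3"
  proof
    assume "N b \<ge> 3"
    then have "card (?L \<inter> Ov) \<ge> 3"
      unfolding N_def A .
    then obtain B where "B \<subseteq> ?L \<inter> Ov" "card B = 3"
      by (rule obtain_subset_with_card_n)
    then show False
      using oval L unfolding is_oval_def collinear_pts_def by blast
  qed
  ultimately show ?thesis
    using False by auto
qed simp

lemma walsh_oval_fun:
  "(\<Sum>x\<in>UNIV. sign (oval_fun m F Ov x + abs_trace (2 * m) (b * x))) =
    int q * (int (card {v \<in> Ov. b * v + (b * v) ^ q = 1}) - 1)"
proof -
  let ?g = "\<lambda>x. sign (oval_fun m F Ov x + abs_trace (2 * m) (b * x))"
  \<comment> \<open>At \<open>x = t * v\<close> the oval function contributes the trace of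
    \<open>t\<close>, and \<open>abs_trace (2 * m) (b * x)\<close> that of \<open>t\<close> times
    the relative trace of \<open>b * v\<close>; \<open>?c v\<close> collects both factors of
    \<open>t\<close>.\<close>
  let ?c = "\<lambda>v. 1 + (b * v + (b * v) ^ q)"
  have c: "?c v \<in> F" for v
    by (simp add: mem_F_iff power_q_add pow_q_q add.commute)
  have g: "?g (t * v) = sign (abs_trace m (t * ?c v))" if "v \<in> Ov" "t \<in> F" for v t
  proof -
    have "oval_fun m F Ov (t * v) = abs_trace m t"
      using that oval_fun_eq[of v "t * v"] Ov_nonzero by (auto simp: multiples_def)
    moreover have "t ^ q = t"
      using that by (simp add: mem_F_iff)
    then have "abs_trace (2 * m) (b * (t * v)) = abs_trace m (t * (b * v + (b * v) ^ q))"
      unfolding abs_trace_double by (simp add: power_mult_distrib algebra_simps)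
    ultimately show ?thesis
      by (simp add: distrib_left abs_trace_add)
  qed
  \<comment> \<open>The -1 removes the term at \<open>t = 0\<close>, whose sign is 1.\<close>
  have "(\<Sum>t\<in>F - {0}. ?g (t * v)) = int q * (if b * v + (b * v) ^ q = 1 then 1 else 0) - 1"
    if v: "v \<in> Ov" for v
  proof -
    have "(\<Sum>t\<in>F. ?g (t * v)) = (\<Sum>t\<in>F. sign (abs_trace m (t * ?c v)))"
      using g v by (intro sum.cong) auto
    also have "\<dots> = (if ?c v = 0 then int q else 0)"
      by (rule sum_sign_abs_trace[OF c])
    finally show ?thesis
      using F_closed(1)
      by (auto simp: sum.remove[of F 0] add_eq_0_iff_eq oval_fun_def sign_def)
  qed
  then have "(\<Sum>x\<in>UNIV. ?g x) =
      1 + (\<Sum>v\<in>Ov. int q * (if b * v + (b * v) ^ q = 1 then 1 else 0) - 1)"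
    by (simp add: sum_K_eq_sum_Ov oval_fun_def sign_def)
  \<comment> \<open>With N solutions on the oval this is 1 + qN - (q + 1).\<close>
  also have "\<dots> = int q * (int (card {v \<in> Ov. b * v + (b * v) ^ q = 1}) - 1)"
    by (simp add: sum_subtractf sum.inter_filter[symmetric] card_Ov algebra_simps
        flip: sum_distrib_left)
  finally show ?thesis .
qed

lemma niho_bent_oval_fun: "niho_bent m F (oval_fun m F Ov)"
proof -
  have "(\<Sum>x\<in>UNIV. sign (oval_fun m F Ov x + abs_trace (2 * m) (b * x))) \<in> {2 ^ m, - (2 ^ m)}" for b
  proof -
    have "int q * (int N - 1) \<in> {2 ^ m, - (2 ^ m)}" if "N \<in> {0, 2}" for N
      using that by (auto simp: q_def)
    then show ?thesis
      unfolding walsh_oval_fun using card_trace_one by blast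
  qed
  then have "bent m (oval_fun m F Ov)"
    unfolding bent_def using oval_fun_range by blast
  moreover have "u \<noteq> 0" if "u ^ (2 ^ m + 1) = 1" for u :: 'a
    using that by auto
  ultimately show ?thesis
    unfolding niho_bent_def using F2_linear_on_oval_fun by blast
qed

section \<open>The explicit polynomial formula\<close>

lemma multiples_indicator:
  assumes "v \<in> Ov" "x \<noteq> 0"
  shows "(x ^ (q ^ 2 - q) - v ^ (q ^ 2 - q)) ^ (q ^ 2 - 1) + 1 =
    (if x \<in> multiples F v then 1 else 0)"
proof -
  have v: "v \<noteq> 0"
    using assms Ov_nonzero by blast
  have pow: "y ^ (q ^ 2 - q) = (y ^ (q - 1)) ^ q" for y :: 'a
    by (simp add: power2_eq_square algebra_simps flip: power_mult)
  \<comment> \<open>The \<open>q\<close>-th power map is an involution, hence injective, so equality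
    of the powers means equality of directions.\<close>
  have "y ^ q = z ^ q \<longleftrightarrow> y = z" for y z :: 'a
    by (metis pow_q_q)
  then have "x ^ (q ^ 2 - q) = v ^ (q ^ 2 - q) \<longleftrightarrow> x \<in> multiples F v"
    using assms v by (simp add: pow mem_multiples_iff div_mem_F_iff)
  moreover have "q ^ 2 - 1 > 0"
    using q_ge_2 one_less_power[of q 2] by simp
  \<comment> \<open>The power \<open>q ^ 2 - 1\<close> sends nonzero differences to 1 and 0 to 0;
    adding 1 swaps these values in characteristic 2.\<close>
  ultimately show ?thesis
    using pow_q_sq_minus_1[of "x ^ (q ^ 2 - q) - v ^ (q ^ 2 - q)"]
    by (simp add: add_eq_0_iff_eq)
qed

lemma oval_fun_formula:
  "oval_fun m F Ov x =
    (\<Sum>v\<in>Ov. ((x ^ (q ^ 2 - q) - v ^ (q ^ 2 - q)) ^ (q ^ 2 - 1) + 1) *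
      (\<Sum>j = 0..m - 1. (x / v) ^ (2 ^ j)))" (is "_ = (\<Sum>v\<in>Ov. ?i v * ?t v)")
proof (cases "x = 0")
  \<comment> \<open>All trace sums vanish here. The indicator reading of the brackets fails at 0:
    they are 0 although 0 lies in every \<open>multiples F v\<close>.\<close>
  case True
  then show ?thesis
    by (simp add: oval_fun_def zero_power)
next
  case False
  obtain w where w: "w \<in> Ov" "x \<in> multiples F w"
    using ex1_multiples[OF False] by blast
  have range: "{0..m - 1} = {..<m}"
    using m_pos by auto
  \<comment> \<open>Only the oval point \<open>w\<close> on the line of \<open>x\<close> survives
    the indicator.\<close>
  have "(\<Sum>v\<in>Ov. ?i v * ?t v) = (\<Sum>v\<in>Ov. if v = w then abs_trace m (x / v) else 0)"
  proof (rule sum.cong)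
    fix v assume v: "v \<in> Ov"
    then have "x \<in> multiples F v \<longleftrightarrow> v = w"
      using w ex1_multiples[OF False] by blast
    then show "?i v * ?t v = (if v = w then abs_trace m (x / v) else 0)"
      unfolding multiples_indicator[OF v False] range by (simp add: abs_trace_def)
  qed simp
  then show ?thesis
    using w by (simp add: oval_fun_eq)
qed

end

theorem theorem3p8:
  fixes F Ov :: "'a::finite_field set" and m q :: nat
  assumes "m \<ge> 1" and "q = 2 ^ m"
    and "card (UNIV :: 'a set) = q ^ 2"
    and "is_subfield F" and "card F = q"
    and "is_oval F Ov" and "is_nucleus F Ov 0"
  shows "(\<forall>L. is_line F L \<and> 0 \<in> L \<longrightarrow> (\<exists>!v. v \<in> Ov \<and> v \<in> L)) \<and>
    (\<forall>x. x \<noteq> 0 \<longrightarrow> (\<exists>!v. v \<in> Ov \<and> x \<in> multiples F v)) \<and>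
    niho_bent m F (oval_fun m F Ov) \<and>
    (\<forall>x. oval_fun m F Ov x =
      (\<Sum>v\<in>Ov. ((x ^ (q ^ 2 - q) - v ^ (q ^ 2 - q)) ^ (q ^ 2 - 1) + 1) *
        (\<Sum>j = 0..m - 1. (x / v) ^ (2 ^ j))))"
proof -
  interpret oval_nucleus_0 F m q Ov
    by unfold_locales (use assms in auto)
  show ?thesis
    using ex1_line ex1_multiples niho_bent_oval_fun oval_fun_formula by blast
qed

end
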